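(* Let $(E,\mathcal E)$, $X$, i.i.d. copies $X_1,X_2,\ldots$, $\phi$, $\Phi(\theta)=\mathbb E[\phi(X,\theta)]$, $g$ and $G(\theta)=\mathbb E[g(X,\theta)]$ be as follows: $\phi:E\times\mathbb R^d\to\mathbb R$ is measurable in its first argument, convex in its second, $\phi(X,\theta)$ integrable for all $\theta$; $g:E\times\mathbb R^d\to\mathbb R^d$ is measurable in its first argument and almost surely $g(X,\theta)$ is a subgradient of $\phi(X,\cdot)$ at $\theta$ for all $\theta$. Assume $\Phi$ has a unique minimizer $\theta^*$, is $\mathcal C^2$ near $\theta^*$ with positive definite Hessian $\nabla^2\Phi(\theta^* )$ (smallest eigenvalue $\lambda_1$); there is $L>0$ with $\|G(\theta)\|\le L\|\theta-\theta^*\|$ for all $\theta$; there is $\eta>0$ with $\mathbb E[\sup_{\theta\in B(\theta^*,\eta)}\|g(X_1,\theta)-G(\theta)\|^2]<\infty$; and $\Gamma=\mathbb E[g(X_1,\theta^* )g(X_1,\theta^* )^\top]$ is finite. Fix $\delta>1/\lambda_1$, deterministic $\theta_0$, and $\theta_k=\theta_{k-1}-\frac{\delta}{k}g(X_k,\theta_{k-1})$. For $n\ge1$ let $\tilde Y^n_k=\frac{k}{\sqrt n}(\theta_k-\theta^* )$, a Markov chain with transition kernels $P^n_k(y,A)=P(\tilde Y^n_k\in A\mid\tilde Y^n_{k-1}=y)$, and define for $t>0,y\in\mathbb R^d$ $$a_n(t,y)=n\,\mathbb E[\tilde Y^n_{\lfloor nt\rfloor}-\tilde Y^n_{\lfloor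 nt\rfloor-1}\mid\tilde Y^n_{\lfloor nt\rfloor-1}=y],$$ $$b_n(t,y)=n\,\mathbb E[(\tilde Y^n_{\lfloor nt\rfloor}-\tilde Y^n_{\lfloor nt\rfloor-1})(\tilde Y^n_{\lfloor nt\rfloor}-\tilde Y^n_{\lfloor nt\rfloor-1})^\top\mid\tilde Y^n_{\lfloor nt\rfloor-1}=y],$$ and $a(t,y)=t^{-1}(I_d-\delta\nabla^2\Phi(\theta^* ))y$. Fix $R,r>0$ and $0<\varepsilon<T$. Then as $n\to\infty$: (i) $\sup_{\varepsilon\le t\le T,\ y\in B(\theta^*,R)} nP^n_{\lfloor nt\rfloor}(y,B(y,r)^\complement)\to0$; (ii) $\sup_{\varepsilon\le t\le T,\ y\in B(\theta^*,R)}\|a_n(t,y)-a(t,y)\|\to0$; (iii) $\sup_{\varepsilon\le t\le T,\ y\in B(\theta^*,R)}\|b_n(t,y)-\delta^2\Gamma\|\to0$.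
   Context: $B(x,\rho)$ denotes the open Euclidean ball of center $x$ and radius $\rho$. *)

theory Defs
  imports "HOL-Probability.Probability"
begin

text \<open>Outer product u v^T as a d x d matrix.\<close>
definition outer :: "real^'d \<Rightarrow> real^'d \<Rightarrow> real^'d^'d" where
  "outer u v = (\<chi> i j. u$i * v$j)"

text \<open>Smallest (real) eigenvalue of a square matrix.\<close>
definition min_eigenvalue :: "real^'d^'d \<Rightarrow> real" where
  "min_eigenvalue A = Min {lam. \<exists>v. v \<noteq> 0 \<and> A *v v = lam *\<^sub>R v}"

text \<open>Phi is C^2 on an open neighbourhood of th0 and its Hessian at th0 is H.\<close>
definition C2_near_with_hessian ::
  "(real^'d \<Rightarrow> real) \<Rightarrow> real^'d \<Rightarrow> real^'d^'d \<Rightarrow> bool" where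
  "C2_near_with_hessian Phi th0 H \<longleftrightarrow>
     (\<exists>U grad Hess. open U \<and> th0 \<in> U \<and>
        (\<forall>th\<in>U. (Phi has_derivative (\<lambda>v. grad th \<bullet> v)) (at th)) \<and>
        (\<forall>th\<in>U. (grad has_derivative (\<lambda>v. Hess th *v v)) (at th)) \<and>
        continuous_on U Hess \<and> Hess th0 = H)"

definition pos_def_matrix :: "real^'d^'d \<Rightarrow> bool" where
  "pos_def_matrix A \<longleftrightarrow> (\<forall>v. v \<noteq> 0 \<longrightarrow> v \<bullet> (A *v v) > 0)"

text \<open>theta_{k-1} as a function of the state y = Y^n_{k-1}
  (for k = 1 the previous iterate is the deterministic theta_0).\<close>
definition sgd_prev :: "real^'d \<Rightarrow> real^'d \<Rightarrow> nat \<Rightarrow> nat \<Rightarrow> real^'d \<Rightarrow> real^'d" where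
  "sgd_prev ths th0 n k y =
     (if k \<le> 1 then th0 else ths + (sqrt (real n) / real (k - 1)) *\<^sub>R y)"

text \<open>Y^n_k as a function of Y^n_{k-1} = y and of the fresh sample X_k = x.\<close>
definition sgd_step ::
  "('e \<Rightarrow> real^'d \<Rightarrow> real^'d) \<Rightarrow> real \<Rightarrow> real^'d \<Rightarrow> real^'d \<Rightarrow>
   nat \<Rightarrow> nat \<Rightarrow> real^'d \<Rightarrow> 'e \<Rightarrow> real^'d" where
  "sgd_step g \<delta> ths th0 n k y x =
     (let thp = sgd_prev ths th0 n k y
      in (real k / sqrt (real n)) *\<^sub>R ((thp - (\<delta> / real k) *\<^sub>R g x thp) - ths))"

text \<open>Transition kernel P^n_k(y,A) = P(Y^n_k \<in> A | Y^n_{k-1} = y), X_k ~ M.\<close>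
definition sgd_kernel ::
  "'e measure \<Rightarrow> ('e \<Rightarrow> real^'d \<Rightarrow> real^'d) \<Rightarrow> real \<Rightarrow> real^'d \<Rightarrow> real^'d \<Rightarrow>
   nat \<Rightarrow> nat \<Rightarrow> real^'d \<Rightarrow> (real^'d) set \<Rightarrow> real" where
  "sgd_kernel M g \<delta> ths th0 n k y A =
     measure M {x \<in> space M. sgd_step g \<delta> ths th0 n k y x \<in> A}"

text \<open>a_n(t,y)\<close>
definition sgd_drift ::
  "'e measure \<Rightarrow> ('e \<Rightarrow> real^'d \<Rightarrow> real^'d) \<Rightarrow> real \<Rightarrow> real^'d \<Rightarrow> real^'d \<Rightarrow>
   nat \<Rightarrow> real \<Rightarrow> real^'d \<Rightarrow> real^'d" where
  "sgd_drift M g \<delta> ths th0 n t y =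
     real n *\<^sub>R (\<integral>x. (sgd_step g \<delta> ths th0 n (nat \<lfloor>real n * t\<rfloor>) y x - y) \<partial>M)"

text \<open>b_n(t,y)\<close>
definition sgd_diffusion ::
  "'e measure \<Rightarrow> ('e \<Rightarrow> real^'d \<Rightarrow> real^'d) \<Rightarrow> real \<Rightarrow> real^'d \<Rightarrow> real^'d \<Rightarrow>
   nat \<Rightarrow> real \<Rightarrow> real^'d \<Rightarrow> real^'d^'d" where
  "sgd_diffusion M g \<delta> ths th0 n t y =
     real n *\<^sub>R (\<integral>x. outer (sgd_step g \<delta> ths th0 n (nat \<lfloor>real n * t\<rfloor>) y x - y)
                           (sgd_step g \<delta> ths th0 n (nat \<lfloor>real n * t\<rfloor>) y x - y) \<partial>M)"

end

theory Submission
  imports Defs "HOL-Real_Asymp.Real_Asymp"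
begin

text \<open>
  Let \<open>k = \<lfloor>n t\<rfloor>\<close> and write \<open>\<theta>\<^sub>k\<^sub>-\<^sub>1 = \<theta>* + h\<close> with \<open>h = sqrt n u\<close>, \<open>u = y / (k - 1)\<close>.
  For \<open>t \<ge> \<epsilon>\<close> and bounded \<open>y\<close> both \<open>n |u|\<close> and \<open>sqrt n |h|\<close> stay bounded, and the
  increment of the rescaled chain is \<open>u - (\<delta> / sqrt n) g(X\<^sub>k, \<theta>* + h)\<close>.

  (i) A jump of size \<open>r\<close> forces the envelope \<open>s = sup\<^bsub>B(\<theta>*,\<eta>)\<^esub> |g - G|\<^sup>2\<close> to exceed a
  multiple of \<open>n\<close> at \<open>X\<^sub>k\<close>, and \<open>n P(s \<ge> a n) \<rightarrow> 0\<close> for integrable \<open>s\<close>.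
  (ii) The drift is \<open>(n / (k - 1)) y - \<delta> sqrt n G(\<theta>* + h)\<close>; near \<open>\<theta>*\<close> the mean field \<open>G\<close> is a
  subgradient, hence the gradient, of \<open>\<Phi>\<close>, so it vanishes at \<open>\<theta>*\<close> with derivative
  \<open>\<nabla>\<^sup>2\<Phi>(\<theta>*)\<close>.
  (iii) The second moment is \<open>\<delta>\<^sup>2 E[g g\<^sup>T](\<theta>* + h) + O(1/n)\<close>, and \<open>E[g g\<^sup>T]\<close> is continuous at
  \<open>\<theta>*\<close> by dominated convergence: \<open>g(x,\<cdot>)\<close> is a.s. continuous at \<open>\<theta>*\<close>, because a subgradient
  of a convex function is continuous where the function is differentiable, and \<open>\<phi>(x,\<cdot>)\<close> is
  a.s. differentiable at \<open>\<theta>*\<close> since the mean excess of its difference quotients over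
  \<open>g(x,\<theta>*)\<close> is \<open>O(t)\<close>.
\<close>

lemma norm_outer: "norm (outer u v) = norm u * norm v"
proof -
  have row: "outer u v $ i = u $ i *\<^sub>R v" for i
    by (simp add: outer_def vec_eq_iff)
  have "norm (outer u v) = L2_set (\<lambda>i. norm (u $ i *\<^sub>R v)) UNIV"
    by (simp add: norm_vec_def row)
  also have "\<dots> = L2_set (\<lambda>i. \<bar>u $ i\<bar>) UNIV * norm v"
    by (simp add: L2_set_left_distrib)
  finally show ?thesis by (simp add: norm_vec_def)
qed

lemma bounded_linear_outer_right: "bounded_linear (outer u)"
  by (rule linear_conv_bounded_linear[THEN iffD1])
    (auto intro!: linearI simp: outer_def vec_eq_iff algebra_simps)

lemma bounded_linear_outer_left: "bounded_linear (\<lambda>v. outer v u)"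
  by (rule linear_conv_bounded_linear[THEN iffD1])
    (auto intro!: linearI simp: outer_def vec_eq_iff algebra_simps)

lemma outer_diff_scaleR_self:
  "outer (u - c *\<^sub>R w) (u - c *\<^sub>R w) = outer u u - c *\<^sub>R (outer u w + outer w u) + c\<^sup>2 *\<^sub>R outer w w"
  by (simp add: outer_def vec_eq_iff algebra_simps power2_eq_square)

lemma continuous_on_outer_self: "continuous_on UNIV (\<lambda>v::real^'d. outer v v)"
  unfolding outer_def by (intro continuous_intros)

lemma SUP_ereal_tendsto_0I:
  fixes F :: "nat \<Rightarrow> 'p \<Rightarrow> real"
  assumes "A \<noteq> {}" and nonneg: "\<And>n p. 0 \<le> F n p"
    and small: "\<And>e. 0 < e \<Longrightarrow> eventually (\<lambda>n. \<forall>p\<in>A. F n p \<le> e) sequentially"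
  shows "((\<lambda>n. SUP p\<in>A. ereal (F n p)) \<longlongrightarrow> 0) sequentially"
proof (rule order_tendstoI)
  fix a :: ereal assume "a < 0"
  from \<open>A \<noteq> {}\<close> obtain p where "p \<in> A" by auto
  have "a < ereal (F n p)" for n
    using \<open>a < 0\<close> nonneg[of n p] by (metis ereal_less_eq(5) order_less_le_trans)
  also have "ereal (F n p) \<le> (SUP p\<in>A. ereal (F n p))" for n
    using \<open>p \<in> A\<close> by (rule SUP_upper)
  finally show "eventually (\<lambda>n. a < (SUP p\<in>A. ereal (F n p))) sequentially"
    by simp
next
  fix a :: ereal assume "0 < a"
  then obtain e where e: "0 < e" "ereal e < a"
    by (metis ereal_dense2 ereal_less(2) less_ereal.simps(1) order_less_trans)
  from small[OF e(1)] show "eventually (\<lambda>n. (SUP p\<in>A. ereal (F n p)) < a) sequentially"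
  proof eventually_elim
    case (elim n)
    then have "(SUP p\<in>A. ereal (F n p)) \<le> ereal e" by (auto intro!: SUP_least)
    then show ?case using e(2) by simp
  qed
qed

lemma tendsto_real_mult_measure_tail_0:
  fixes s :: "'a \<Rightarrow> real"
  assumes s: "integrable M s" "\<And>x. 0 \<le> s x" and a: "0 < a"
  shows "(\<lambda>n. real n * measure M {x \<in> space M. a * real n \<le> s x}) \<longlonglongrightarrow> 0"
proof -
  define B where "B n = {x \<in> space M. a * real n \<le> s x}" for n :: nat
  have [measurable]: "s \<in> borel_measurable M" using s by auto
  have B_sets [measurable]: "B n \<in> sets M" for n unfolding B_def by measurable
  have tail: "(\<lambda>n. \<integral>x. s x * indicator (B n) x \<partial>M) \<longlonglongrightarrow> (\<integral>x. 0 \<partial>M)"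
  proof (rule integral_dominated_convergence[where w=s])
    show "AE x in M. (\<lambda>n. s x * indicator (B n) x) \<longlonglongrightarrow> 0"
    proof (rule AE_I2, rule tendsto_eventually)
      fix x
      have "eventually (\<lambda>n. s x / a < real n) sequentially"
        using filterlim_real_sequentially unfolding filterlim_at_top_dense by blast
      then show "eventually (\<lambda>n. s x * indicator (B n) x = 0) sequentially"
        by eventually_elim (use a in \<open>auto simp: B_def field_simps\<close>)
    qed
    show "AE x in M. norm (s x * indicator (B n) x) \<le> s x" for n
      using s(2) by (intro AE_I2) (auto split: split_indicator)
  qed (use s in auto)
  have bound: "real n * measure M (B n) \<le> (\<integral>x. s x * indicator (B n) x \<partial>M) / a" for n
  proof (cases "n = 0")
    case False
    then have an: "0 < a * real n" using a by simp
    have "measure M (B n) = measure M {x \<in> space M. a * real n \<le> s x * indicator (B n) x}"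
      using an by (intro arg_cong[where f="measure M"]) (auto simp: B_def split: split_indicator)
    also have "\<dots> \<le> (\<integral>x. s x * indicator (B n) x \<partial>M) / (a * real n)"
      using an s by (intro integral_Markov_inequality_measure[where A="space M"]
          integrable_real_mult_indicator) auto
    finally show ?thesis using a False by (simp add: field_simps)
  qed (use s in \<open>auto intro!: divide_nonneg_pos integral_nonneg_AE a\<close>)
  show ?thesis unfolding B_def[symmetric]
  proof (rule tendsto_sandwich[OF _ _ tendsto_const])
    show "eventually (\<lambda>n. real n * measure M (B n) \<le> (\<integral>x. s x * indicator (B n) x \<partial>M) / a) sequentially"
      using bound by simp
    show "(\<lambda>n. (\<integral>x. s x * indicator (B n) x \<partial>M) / a) \<longlonglongrightarrow> 0"
      using tendsto_divide[OF tail tendsto_const, of a] a by simp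
  qed simp
qed

lemma AE_ex_less_of_integral_tendsto_0:
  fixes C :: "nat \<Rightarrow> 'a \<Rightarrow> real"
  assumes int: "\<And>j. integrable M (C j)" and nonneg: "AE x in M. \<forall>j. 0 \<le> C j x"
    and lim: "(\<lambda>j. \<integral>x. C j x \<partial>M) \<longlonglongrightarrow> 0"
  shows "AE x in M. \<forall>e>0. \<exists>j. C j x < e"
proof -
  define I where "I x = (INF j. ennreal (C j x))" for x
  have [measurable]: "C j \<in> borel_measurable M" for j using int by auto
  have I_meas: "I \<in> borel_measurable M" unfolding I_def by measurable
  have "(\<integral>\<^sup>+x. I x \<partial>M) \<le> 0"
  proof (rule ennreal_le_epsilon)
    fix e :: real assume "0 < e"
    have "eventually (\<lambda>j. (\<integral>x. C j x \<partial>M) < e) sequentially"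
      using lim \<open>0 < e\<close> by (rule order_tendstoD(2))
    then obtain j where j: "(\<integral>x. C j x \<partial>M) < e"
      by (auto simp: eventually_sequentially)
    have "(\<integral>\<^sup>+x. I x \<partial>M) \<le> (\<integral>\<^sup>+x. ennreal (C j x) \<partial>M)"
      unfolding I_def by (intro nn_integral_mono INF_lower) auto
    also have "\<dots> = ennreal (\<integral>x. C j x \<partial>M)"
      using nonneg by (intro nn_integral_eq_integral int) (auto elim: AE_mp)
    also have "\<dots> \<le> ennreal e" using j by (intro ennreal_leI) simp
    finally show "(\<integral>\<^sup>+x. I x \<partial>M) \<le> 0 + ennreal e" by simp
  qed
  then have "AE x in M. I x = 0" using nn_integral_0_iff_AE[OF I_meas] by simp
  then show ?thesis using nonneg
  proof eventually_elim
    case (elim x)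
    show ?case
    proof (intro allI impI)
      fix e :: real assume "0 < e"
      then have "(INF j. ennreal (C j x)) < ennreal e" using elim(1) by (simp add: I_def)
      then obtain j where "ennreal (C j x) < ennreal e" by (auto simp: INF_less_iff)
      then show "\<exists>j. C j x < e" using elim(2) by (auto simp: ennreal_less_iff)
    qed
  qed
qed

lemma subgradient_eq_derivative:
  fixes f :: "'a::real_inner \<Rightarrow> real"
  assumes deriv: "(f has_derivative (\<lambda>v. a \<bullet> v)) (at z)"
    and subgrad: "\<And>z'. f z + b \<bullet> (z' - z) \<le> f z'"
  shows "a = b"
proof -
  have "((\<lambda>z'. f z' - b \<bullet> (z' - z)) has_derivative (\<lambda>v. a \<bullet> v - b \<bullet> v)) (at z)"
    by (auto intro!: derivative_eq_intros deriv)
  moreover have "\<forall>\<^sub>F z' in at z. f z - b \<bullet> (z - z) \<le> f z' - b \<bullet> (z' - z)"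
    using subgrad by (intro always_eventually) (simp add: algebra_simps)
  ultimately have "(\<lambda>v. a \<bullet> v - b \<bullet> v) = (\<lambda>v. 0)"
    by (rule has_derivative_local_min)
  then have "(a - b) \<bullet> (a - b) = 0" by (metis inner_diff_left)
  then show ?thesis by simp
qed

lemma isCont_subgradient:
  fixes f :: "real^'d \<Rightarrow> real" and f' :: "real^'d \<Rightarrow> real^'d"
  assumes "convex_on UNIV f"
    and subgrad: "\<And>\<theta> \<theta>'. f \<theta> + f' \<theta> \<bullet> (\<theta>' - \<theta>) \<le> f \<theta>'"
    \<comment> \<open>the one-sided derivatives of f at z along \<open>\<plusminus>\<close> each axis do not exceed those of
      \<open>f' z\<close>, i.e. f is differentiable at z\<close>
    and directional: "\<And>i w e. w \<in> {axis i 1, - axis i 1} \<Longrightarrow> 0 < e \<Longrightarrow>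
      \<exists>t>0. (f (z + t *\<^sub>R w) - f z) / t \<le> f' z \<bullet> w + e"
  shows "isCont f' z"
proof -
  have cont: "isCont f p" for p
    using convex_on_continuous[OF open_UNIV \<open>convex_on UNIV f\<close>]
    by (simp add: continuous_on_eq_continuous_at)
  have upper: "\<forall>\<^sub>F v in at z. f' v \<bullet> w < f' z \<bullet> w + e"
    if w: "w \<in> {axis i 1, - axis i 1}" and e: "0 < e" for i w e
  proof -
    obtain t where t: "0 < t" "(f (z + t *\<^sub>R w) - f z) / t \<le> f' z \<bullet> w + e / 2"
      using directional[OF w] e by (meson half_gt_zero)
    have "((\<lambda>v. f (v + t *\<^sub>R w)) \<longlongrightarrow> f (z + t *\<^sub>R w)) (at z)"
      by (intro isCont_tendsto_compose[OF cont] tendsto_intros)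
    then have "((\<lambda>v. (f (v + t *\<^sub>R w) - f v) / t) \<longlongrightarrow> (f (z + t *\<^sub>R w) - f z) / t) (at z)"
      using cont[of z] t(1) by (intro tendsto_intros) (auto simp: isCont_def)
    then have "\<forall>\<^sub>F v in at z. (f (v + t *\<^sub>R w) - f v) / t < (f (z + t *\<^sub>R w) - f z) / t + e / 2"
      using e by (intro order_tendstoD(2)) auto
    then show ?thesis
    proof eventually_elim
      case (elim v)
      have "t * (f' v \<bullet> w) \<le> f (v + t *\<^sub>R w) - f v"
        using subgrad[of v "v + t *\<^sub>R w"] by simp
      then have "f' v \<bullet> w \<le> (f (v + t *\<^sub>R w) - f v) / t" using t(1) by (simp add: field_simps)
      then show ?case using elim t(2) by linarith
    qed
  qed
  show ?thesis unfolding isCont_def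
  proof (rule vec_tendstoI, rule tendstoI)
    fix i and e :: real assume "0 < e"
    have "\<forall>\<^sub>F v in at z. f' v $ i < f' z $ i + e"
      using upper[of "axis i 1" i e] \<open>0 < e\<close> by (simp add: inner_axis)
    moreover have "\<forall>\<^sub>F v in at z. - f' v $ i < - f' z $ i + e"
      using upper[of "- axis i 1" i e] \<open>0 < e\<close> by (simp add: inner_axis)
    ultimately show "\<forall>\<^sub>F v in at z. dist (f' v $ i) (f' z $ i) < e"
      by eventually_elim (simp add: dist_real_def abs_less_iff)
  qed
qed

lemma integrable_envelope_enn2real_SUP:
  fixes F :: "'a \<Rightarrow> 'i \<Rightarrow> real" and I :: "'i set"
  defines "S \<equiv> \<lambda>x. SUP i\<in>I. ennreal (F x i)"
  assumes meas: "S \<in> borel_measurable M" and fin: "(\<integral>\<^sup>+x. S x \<partial>M) < \<infinity>"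
  shows "integrable M (\<lambda>x. enn2real (S x))"
    and "AE x in M. \<forall>i\<in>I. F x i \<le> enn2real (S x)"
proof -
  have "(\<integral>\<^sup>+x. ennreal (norm (enn2real (S x))) \<partial>M) \<le> (\<integral>\<^sup>+x. S x \<partial>M)"
    by (intro nn_integral_mono) (simp add: ennreal_enn2real_if)
  then show "integrable M (\<lambda>x. enn2real (S x))"
    using meas fin by (intro integrableI_bounded) auto
  have "AE x in M. S x \<noteq> \<infinity>"
    using meas fin by (intro nn_integral_noteq_infinite) auto
  then show "AE x in M. \<forall>i\<in>I. F x i \<le> enn2real (S x)"
  proof eventually_elim
    case (elim x)
    have "F x i \<le> enn2real (S x)" if "i \<in> I" for i
    proof -
      have "ennreal (F x i) \<le> S x" unfolding S_def using that by (rule SUP_upper)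
      then have "enn2real (ennreal (F x i)) \<le> enn2real (S x)"
        using elim by (intro enn2real_mono) (auto simp: top.not_eq_extremum)
      then show ?thesis by (smt (verit) enn2real_ennreal enn2real_nonneg)
    qed
    then show ?case by blast
  qed
qed

lemma floor_time_index_bounds:
  fixes n :: nat
  assumes n: "4 \<le> real n * \<epsilon>" and \<epsilon>: "0 < \<epsilon>" "\<epsilon> \<le> t"
  defines "k \<equiv> nat \<lfloor>real n * t\<rfloor>"
  shows "2 \<le> k" "real n * \<epsilon> / 2 \<le> real (k - 1)"
    "\<bar>real n / real (k - 1) - 1 / t\<bar> \<le> 4 / (\<epsilon>\<^sup>2 * real n)"
proof -
  have nt: "real n * \<epsilon> \<le> real n * t" using \<epsilon> by (intro mult_left_mono) auto
  have k: "real k \<le> real n * t" "real n * t < real k + 1" unfolding k_def using nt n by linarith+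
  show "2 \<le> k" using k nt n by linarith
  then have k1: "real (k - 1) = real k - 1" by simp
  show kk: "real n * \<epsilon> / 2 \<le> real (k - 1)" using k nt n unfolding k1 by linarith
  have pos: "0 < t" "0 < real (k - 1)" "0 < \<epsilon> * (real n * \<epsilon> / 2)" using \<epsilon> n kk by auto
  have "\<bar>real n / real (k - 1) - 1 / t\<bar> = (real n * t - real (k - 1)) / (t * real (k - 1))"
    using pos k unfolding k1 by (simp add: field_simps)
  also have "\<dots> \<le> 2 / (\<epsilon> * (real n * \<epsilon> / 2))"
    using k pos \<epsilon> kk unfolding k1 by (intro frac_le mult_mono) auto
  also have "\<dots> = 4 / (\<epsilon>\<^sup>2 * real n)" by (simp add: power2_eq_square)
  finally show "\<bar>real n / real (k - 1) - 1 / t\<bar> \<le> 4 / (\<epsilon>\<^sup>2 * real n)" .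
qed

lemma sgd_step_increment_eq:
  assumes "0 < n" "2 \<le> k"
  shows "sgd_step g \<delta> ths th0 n k y x - y =
    (1 / real (k - 1)) *\<^sub>R y - (\<delta> / sqrt (real n)) *\<^sub>R g x (ths + (sqrt (real n) / real (k - 1)) *\<^sub>R y)"
proof -
  have k: "real (k - 1) = real k - 1" "real k - 1 > 0" using assms by auto
  have "real k / sqrt (real n) * (sqrt (real n) / real (k - 1)) = 1 + 1 / real (k - 1)"
    and "real k / sqrt (real n) * (\<delta> / real k) = \<delta> / sqrt (real n)"
    using assms k by (simp_all add: field_simps)
  then show ?thesis using assms
    by (simp add: sgd_step_def sgd_prev_def Let_def scaleR_diff_right scaleR_add_left algebra_simps)
qed

lemma sgd_step_rescaled:
  fixes n :: nat
  assumes n: "4 \<le> real n * \<epsilon>" and \<epsilon>: "0 < \<epsilon>" "\<epsilon> \<le> t" and y: "norm y \<le> c"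
  defines "Q \<equiv> 2 * c / \<epsilon>"
  obtains kk u where "0 < n" "u = (1 / kk) *\<^sub>R y" "\<bar>real n / kk - 1 / t\<bar> \<le> 4 / (\<epsilon>\<^sup>2 * real n)"
    "real n * norm u \<le> Q" "norm u \<le> Q / real n"
    "sqrt (real n) * norm (sqrt (real n) *\<^sub>R u) \<le> Q" "norm (sqrt (real n) *\<^sub>R u) \<le> Q / sqrt (real n)"
    "\<And>x. sgd_step g \<delta> ths th0 n (nat \<lfloor>real n * t\<rfloor>) y x - y =
      u - (\<delta> / sqrt (real n)) *\<^sub>R g x (ths + sqrt (real n) *\<^sub>R u)"
proof -
  note k = floor_time_index_bounds[OF n \<epsilon>]
  \<comment> \<open>with \<open>k = \<lfloor>n t\<rfloor>\<close>, \<open>kk = k - 1\<close> and \<open>sqrt n *\<^sub>R u = \<theta>\<^sub>k\<^sub>-\<^sub>1 - \<theta>*\<close>\<close>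
  define kk where "kk = real (nat \<lfloor>real n * t\<rfloor> - 1)"
  define u where "u = (1 / kk) *\<^sub>R y"
  have pos: "0 < real n * \<epsilon>" using n by linarith
  then have n0: "0 < n" using \<epsilon> by (simp add: zero_less_mult_iff)
  have kk: "0 < kk" "real n * \<epsilon> / 2 \<le> kk" using k(2) pos unfolding kk_def by linarith+
  have "real n * norm u = real n * norm y / kk" using kk by (simp add: u_def)
  also have "\<dots> \<le> real n * c / (real n * \<epsilon> / 2)"
    using y kk pos order_trans[OF norm_ge_zero y]
    by (intro frac_le mult_left_mono mult_nonneg_nonneg) auto
  also have "\<dots> = Q" using n0 \<epsilon> by (simp add: Q_def field_simps)
  finally have nu: "real n * norm u \<le> Q" .
  have sq: "sqrt (real n) * sqrt (real n) = real n" by simp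
  show ?thesis
  proof (rule that[OF n0 u_def k(3)[folded kk_def] nu])
    show "norm u \<le> Q / real n" using nu n0 by (simp add: field_simps)
    show "sqrt (real n) * norm (sqrt (real n) *\<^sub>R u) \<le> Q"
      using nu by (simp add: mult.assoc[symmetric] sq)
    then show "norm (sqrt (real n) *\<^sub>R u) \<le> Q / sqrt (real n)" using n0 by (simp add: field_simps)
    show "sgd_step g \<delta> ths th0 n (nat \<lfloor>real n * t\<rfloor>) y x - y =
      u - (\<delta> / sqrt (real n)) *\<^sub>R g x (ths + sqrt (real n) *\<^sub>R u)" for x
      using sgd_step_increment_eq[OF n0 k(1)] unfolding kk_def u_def by simp
  qed
qed

locale sgd_noise = prob_space M
  for M :: "'e measure" +
  fixes g :: "'e \<Rightarrow> real^'d \<Rightarrow> real^'d" and G :: "real^'d \<Rightarrow> real^'d"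
    and ths :: "real^'d" and L \<eta> :: real and s :: "'e \<Rightarrow> real"
  assumes g_measurable: "\<And>\<theta>. (\<lambda>x. g x \<theta>) \<in> borel_measurable M"
    and G_eq: "G = (\<lambda>\<theta>. \<integral>x. g x \<theta> \<partial>M)"
    and L_pos: "0 < L" and norm_G_le: "\<And>\<theta>. norm (G \<theta>) \<le> L * norm (\<theta> - ths)"
    and eta_pos: "0 < \<eta>"
    and s_nonneg: "\<And>x. 0 \<le> s x" and integrable_s: "integrable M s"
    and AE_noise_le: "AE x in M. \<forall>\<theta>\<in>ball ths \<eta>. (norm (g x \<theta> - G \<theta>))\<^sup>2 \<le> s x"
begin

definition second_moment :: "real^'d \<Rightarrow> real^'d^'d" where
  "second_moment \<theta> = (\<integral>x. outer (g x \<theta>) (g x \<theta>) \<partial>M)"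

lemma G_ths: "G ths = 0"
  using norm_G_le[of ths] by simp

lemma norm_G_le_ball: "\<theta> \<in> ball ths \<eta> \<Longrightarrow> norm (G \<theta>) \<le> L * \<eta>"
  using norm_G_le[of \<theta>] L_pos
  by (smt (verit) dist_norm mem_ball mult_left_mono norm_minus_commute)

lemma integrable_g:
  assumes "\<theta> \<in> ball ths \<eta>"
  shows "integrable M (\<lambda>x. g x \<theta>)"
proof -
  have "integrable M (\<lambda>x. g x \<theta> - G \<theta>)"
  proof (rule Bochner_Integration.integrable_bound[where f="\<lambda>x. 1 + s x"])
    show "integrable M (\<lambda>x. 1 + s x)" using integrable_s by simp
    show "(\<lambda>x. g x \<theta> - G \<theta>) \<in> borel_measurable M" using g_measurable by measurable
    show "AE x in M. norm (g x \<theta> - G \<theta>) \<le> norm (1 + s x)"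
      using AE_noise_le
    proof eventually_elim
      case (elim x)
      let ?z = "norm (g x \<theta> - G \<theta>)"
      have "2 * ?z \<le> ?z\<^sup>2 + 1" using zero_le_power2[of "?z - 1"] by (simp add: power2_diff)
      moreover have "?z\<^sup>2 \<le> s x" using elim assms by blast
      ultimately show ?case using s_nonneg[of x] zero_le_power2[of ?z] by simp
    qed
  qed
  then have "integrable M (\<lambda>x. (g x \<theta> - G \<theta>) + G \<theta>)"
    by (rule Bochner_Integration.integrable_add[OF _ integrable_const])
  then show ?thesis by simp
qed

lemma AE_norm_outer_g_le:
  assumes "\<theta> \<in> ball ths \<eta>"
  shows "AE x in M. norm (outer (g x \<theta>) (g x \<theta>)) \<le> 2 * s x + 2 * (L * \<eta>)\<^sup>2"
  using AE_noise_le
proof eventually_elim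
  case (elim x)
  let ?a = "norm (g x \<theta> - G \<theta>)" and ?b = "norm (G \<theta>)"
  have "norm (g x \<theta>) \<le> ?a + ?b" by (metis diff_add_cancel norm_triangle_ineq)
  then have "(norm (g x \<theta>))\<^sup>2 \<le> (?a + ?b)\<^sup>2" by (intro power_mono) auto
  also have "\<dots> \<le> 2 * ?a\<^sup>2 + 2 * ?b\<^sup>2"
    using zero_le_power2[of "?a - ?b"] unfolding power2_diff power2_sum by linarith
  also have "\<dots> \<le> 2 * s x + 2 * (L * \<eta>)\<^sup>2"
    using elim assms power_mono[OF norm_G_le_ball[OF assms] norm_ge_zero, of 2] by fastforce
  finally show ?case by (simp add: norm_outer power2_eq_square)
qed

lemma integrable_outer_g:
  assumes "\<theta> \<in> ball ths \<eta>"
  shows "integrable M (\<lambda>x. outer (g x \<theta>) (g x \<theta>))"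
proof (rule Bochner_Integration.integrable_bound[where f="\<lambda>x. 2 * s x + 2 * (L * \<eta>)\<^sup>2"])
  show "integrable M (\<lambda>x. 2 * s x + 2 * (L * \<eta>)\<^sup>2)" using integrable_s by simp
  show "(\<lambda>x. outer (g x \<theta>) (g x \<theta>)) \<in> borel_measurable M"
    by (rule borel_measurable_continuous_on[OF continuous_on_outer_self g_measurable])
  show "AE x in M. norm (outer (g x \<theta>) (g x \<theta>)) \<le> norm (2 * s x + 2 * (L * \<eta>)\<^sup>2)"
    using AE_norm_outer_g_le[OF assms] by eventually_elim (simp add: s_nonneg)
qed

lemma integral_diff_scaleR_g:
  assumes "\<theta> \<in> ball ths \<eta>"
  shows "(\<integral>x. u - c *\<^sub>R g x \<theta> \<partial>M) = u - c *\<^sub>R G \<theta>"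
  using integrable_g[OF assms] by (simp add: G_eq prob_space)

lemma integral_outer_diff_scaleR_g:
  assumes "\<theta> \<in> ball ths \<eta>"
  shows "(\<integral>x. outer (u - c *\<^sub>R g x \<theta>) (u - c *\<^sub>R g x \<theta>) \<partial>M)
    = outer u u - c *\<^sub>R (outer u (G \<theta>) + outer (G \<theta>) u) + c\<^sup>2 *\<^sub>R second_moment \<theta>"
proof -
  note g = integrable_g[OF assms]
  have "integrable M (\<lambda>x. outer u (g x \<theta>))" "integrable M (\<lambda>x. outer (g x \<theta>) u)"
    using integrable_bounded_linear[OF bounded_linear_outer_right g]
      integrable_bounded_linear[OF bounded_linear_outer_left g] by simp_all
  moreover have "(\<integral>x. outer u (g x \<theta>) \<partial>M) = outer u (G \<theta>)"
    "(\<integral>x. outer (g x \<theta>) u \<partial>M) = outer (G \<theta>) u"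
    unfolding G_eq using integral_bounded_linear[OF bounded_linear_outer_right g]
      integral_bounded_linear[OF bounded_linear_outer_left g] by simp_all
  ultimately show ?thesis
    using integrable_outer_g[OF assms]
    by (simp add: outer_diff_scaleR_self second_moment_def prob_space)
qed

lemma isCont_second_moment:
  assumes cont: "AE x in M. isCont (g x) ths"
  shows "isCont second_moment ths"
proof (rule continuous_at_sequentiallyI)
  fix v assume v: "v \<longlonglongrightarrow> ths"
  have "eventually (\<lambda>m. dist (v m) ths < \<eta>) sequentially" using v eta_pos by (rule tendstoD)
  then obtain N where N: "\<And>m. N \<le> m \<Longrightarrow> v m \<in> ball ths \<eta>"
    by (auto simp: eventually_sequentially dist_commute)
  show "(\<lambda>m. second_moment (v m)) \<longlonglongrightarrow> second_moment ths"
    unfolding second_moment_def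
  proof (rule LIMSEQ_offset[where k=N],
      rule integral_dominated_convergence[where w="\<lambda>x. 2 * s x + 2 * (L * \<eta>)\<^sup>2"])
    show "AE x in M. (\<lambda>m. outer (g x (v (m + N))) (g x (v (m + N)))) \<longlonglongrightarrow> outer (g x ths) (g x ths)"
      using cont
    proof eventually_elim
      case (elim x)
      have "(\<lambda>m. g x (v (m + N))) \<longlonglongrightarrow> g x ths"
        using isCont_tendsto_compose[OF elim LIMSEQ_ignore_initial_segment[OF v]] .
      then show ?case unfolding outer_def by (intro tendsto_intros)
    qed
    show "AE x in M. norm (outer (g x (v (m + N))) (g x (v (m + N)))) \<le> 2 * s x + 2 * (L * \<eta>)\<^sup>2" for m
      using AE_norm_outer_g_le[OF N] by simp
  qed (use integrable_s in \<open>auto intro: borel_measurable_continuous_on[OF continuous_on_outer_self g_measurable]\<close>)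
qed

lemma AE_escape_imp_large_noise:
  assumes \<sigma>: "1 \<le> \<sigma>" and u: "norm u < r / 2" and h: "norm (\<sigma> *\<^sub>R u) < \<eta>"
    and Lh: "L * norm (\<sigma> *\<^sub>R u) \<le> r / (4 * (\<bar>\<delta>\<bar> + 1))"
  shows "AE x in M. r \<le> norm (u - (\<delta> / \<sigma>) *\<^sub>R g x (ths + \<sigma> *\<^sub>R u)) \<longrightarrow>
    (r * \<sigma> / (4 * (\<bar>\<delta>\<bar> + 1)))\<^sup>2 < s x"
  using AE_noise_le
proof eventually_elim
  case (elim x)
  define D where "D = \<bar>\<delta>\<bar> + 1"
  define \<theta> where "\<theta> = ths + \<sigma> *\<^sub>R u"
  have D: "0 < D" "\<bar>\<delta>\<bar> \<le> D" by (auto simp: D_def)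
  have r: "0 < r" using u norm_ge_zero[of u] by linarith
  have "\<theta> \<in> ball ths \<eta>" using h by (simp add: \<theta>_def dist_norm)
  then have "norm (g x \<theta> - G \<theta>) \<le> sqrt (s x)" using elim by (simp add: real_le_rsqrt)
  moreover have "norm (G \<theta>) \<le> r / (4 * D)" using norm_G_le[of \<theta>] Lh by (simp add: \<theta>_def D_def)
  ultimately have norm_g: "norm (g x \<theta>) \<le> sqrt (s x) + r / (4 * D)"
    by (smt (verit) diff_add_cancel norm_triangle_ineq)
  show ?case unfolding \<theta>_def[symmetric] D_def[symmetric]
  proof
    assume "r \<le> norm (u - (\<delta> / \<sigma>) *\<^sub>R g x \<theta>)"
    then have "r / 2 < norm ((\<delta> / \<sigma>) *\<^sub>R g x \<theta>)"
      using u norm_triangle_ineq4[of u "(\<delta> / \<sigma>) *\<^sub>R g x \<theta>"] by linarith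
    then have "r * \<sigma> / 2 < \<bar>\<delta>\<bar> * norm (g x \<theta>)" using \<sigma> by (simp add: field_simps)
    also have "\<dots> \<le> D * (sqrt (s x) + r / (4 * D))" using D norm_g by (intro mult_mono) auto
    also have "\<dots> = D * sqrt (s x) + r / 4" using D by (simp add: field_simps)
    finally have "r * \<sigma> / 4 < D * sqrt (s x)"
      using mult_left_mono[OF \<sigma>, of r] r by linarith
    then have "r * \<sigma> / (4 * D) < sqrt (s x)" using D by (simp add: field_simps)
    then have "(r * \<sigma> / (4 * D))\<^sup>2 < (sqrt (s x))\<^sup>2"
      using D r \<sigma> by (intro power_strict_mono) auto
    then show "(r * \<sigma> / (4 * D))\<^sup>2 < s x" using s_nonneg[of x] by simp
  qed
qed

lemma sgd_kernel_escape_le: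
  fixes n :: nat
  assumes n: "4 \<le> real n * \<epsilon>" and \<epsilon>: "0 < \<epsilon>" "\<epsilon> \<le> t" and y: "norm y \<le> c"
    and small: "2 * c / \<epsilon> / real n < r / 2" "2 * c / \<epsilon> / sqrt (real n) < \<eta>"
      "L * (2 * c / \<epsilon> / sqrt (real n)) \<le> r / (4 * (\<bar>\<delta>\<bar> + 1))"
  shows "sgd_kernel M g \<delta> ths th0 n (nat \<lfloor>real n * t\<rfloor>) y (- ball y r)
    \<le> measure M {x \<in> space M. (r / (4 * (\<bar>\<delta>\<bar> + 1)))\<^sup>2 * real n \<le> s x}"
proof -
  obtain kk u where n0: "0 < n" and u: "norm u \<le> 2 * c / \<epsilon> / real n"
      "norm (sqrt (real n) *\<^sub>R u) \<le> 2 * c / \<epsilon> / sqrt (real n)"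
    and step: "\<And>x. sgd_step g \<delta> ths th0 n (nat \<lfloor>real n * t\<rfloor>) y x - y =
      u - (\<delta> / sqrt (real n)) *\<^sub>R g x (ths + sqrt (real n) *\<^sub>R u)"
    using sgd_step_rescaled[OF n \<epsilon> y] by metis
  have "AE x in M. r \<le> norm (u - (\<delta> / sqrt (real n)) *\<^sub>R g x (ths + sqrt (real n) *\<^sub>R u)) \<longrightarrow>
      (r * sqrt (real n) / (4 * (\<bar>\<delta>\<bar> + 1)))\<^sup>2 < s x"
    using n0 u small L_pos
    by (intro AE_escape_imp_large_noise) (auto intro: order_trans[OF mult_left_mono])
  then have "AE x in M. x \<in> {x \<in> space M. sgd_step g \<delta> ths th0 n (nat \<lfloor>real n * t\<rfloor>) y x \<in> - ball y r}
      \<longrightarrow> x \<in> {x \<in> space M. (r / (4 * (\<bar>\<delta>\<bar> + 1)))\<^sup>2 * real n \<le> s x}"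
  proof eventually_elim
    case (elim x)
    have "dist y (sgd_step g \<delta> ths th0 n (nat \<lfloor>real n * t\<rfloor>) y x)
        = norm (u - (\<delta> / sqrt (real n)) *\<^sub>R g x (ths + sqrt (real n) *\<^sub>R u))"
      by (simp only: dist_norm norm_minus_commute[of y] step)
    moreover have "(r * sqrt (real n) / (4 * (\<bar>\<delta>\<bar> + 1)))\<^sup>2 = (r / (4 * (\<bar>\<delta>\<bar> + 1)))\<^sup>2 * real n"
      by (simp add: power_divide power_mult_distrib)
    ultimately show ?case using elim by auto
  qed
  then show ?thesis
    unfolding sgd_kernel_def by (rule finite_measure_mono_AE) (use integrable_s in auto)
qed

lemma sgd_kernel_escape_tendsto_0:
  assumes S: "S \<noteq> {}" "\<And>t y. (t, y) \<in> S \<Longrightarrow> \<epsilon> \<le> t \<and> norm y \<le> c"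
    and \<epsilon>: "0 < \<epsilon>" and r: "0 < r"
  shows "((\<lambda>n. SUP p\<in>S. ereal (real n * sgd_kernel M g \<delta> ths th0 n (nat \<lfloor>real n * fst p\<rfloor>)
    (snd p) (- ball (snd p) r))) \<longlongrightarrow> 0) sequentially"
proof (rule SUP_ereal_tendsto_0I[OF S(1)])
  show "0 \<le> real n * sgd_kernel M g \<delta> ths th0 n k y A" for n k y A
    by (simp add: sgd_kernel_def)
  fix e :: real assume "0 < e"
  define a where "a = (r / (4 * (\<bar>\<delta>\<bar> + 1)))\<^sup>2"
  define Q where "Q = 2 * c / \<epsilon>"
  have "(\<lambda>n. real n * measure M {x \<in> space M. a * real n \<le> s x}) \<longlonglongrightarrow> 0"
    using r by (intro tendsto_real_mult_measure_tail_0 integrable_s s_nonneg) (simp add: a_def)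
  then have "\<forall>\<^sub>F n in sequentially. real n * measure M {x \<in> space M. a * real n \<le> s x} < e"
    using \<open>0 < e\<close> by (rule order_tendstoD(2))
  moreover have "\<forall>\<^sub>F n in sequentially. 4 \<le> real n * \<epsilon>" using \<epsilon> by real_asymp
  moreover have "\<forall>\<^sub>F n in sequentially. Q / real n < r / 2"
    by (rule order_tendstoD(2)[OF _ half_gt_zero[OF r]]) real_asymp
  moreover have "\<forall>\<^sub>F n in sequentially. Q / sqrt (real n) < \<eta>"
    by (rule order_tendstoD(2)[OF _ eta_pos]) real_asymp
  moreover have "\<forall>\<^sub>F n in sequentially. L * (Q / sqrt (real n)) < r / (4 * (\<bar>\<delta>\<bar> + 1))"
    using r by (intro order_tendstoD(2)[of _ 0]) (real_asymp, simp add: add_pos_nonneg)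
  ultimately show "\<forall>\<^sub>F n in sequentially. \<forall>p\<in>S. real n * sgd_kernel M g \<delta> ths th0 n
      (nat \<lfloor>real n * fst p\<rfloor>) (snd p) (- ball (snd p) r) \<le> e"
  proof eventually_elim
    case (elim n)
    show ?case
    proof
      fix p assume "p \<in> S"
      then obtain t y where p: "p = (t, y)" "\<epsilon> \<le> t" "norm y \<le> c" using S(2) by (cases p) blast
      have "sgd_kernel M g \<delta> ths th0 n (nat \<lfloor>real n * t\<rfloor>) y (- ball y r)
          \<le> measure M {x \<in> space M. a * real n \<le> s x}"
        unfolding a_def using elim p \<epsilon> by (intro sgd_kernel_escape_le) (auto simp: Q_def)
      then have "real n * sgd_kernel M g \<delta> ths th0 n (nat \<lfloor>real n * t\<rfloor>) y (- ball y r)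
          \<le> real n * measure M {x \<in> space M. a * real n \<le> s x}"
        by (rule mult_left_mono) simp
      then show "real n * sgd_kernel M g \<delta> ths th0 n (nat \<lfloor>real n * fst p\<rfloor>) (snd p) (- ball (snd p) r) \<le> e"
        using elim(1) p(1) by simp
    qed
  qed
qed

lemma sgd_drift_error_eq:
  assumes n: "0 < n" and h: "norm (sqrt (real n) *\<^sub>R u) < \<eta>" and u: "u = (1 / kk) *\<^sub>R y"
    and step: "\<And>x. sgd_step g \<delta> ths th0 n (nat \<lfloor>real n * t\<rfloor>) y x - y =
      u - (\<delta> / sqrt (real n)) *\<^sub>R g x (ths + sqrt (real n) *\<^sub>R u)"
  shows "sgd_drift M g \<delta> ths th0 n t y - (1 / t) *\<^sub>R ((mat 1 - \<delta> *\<^sub>R H) *v y)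
    = (real n / kk - 1 / t) *\<^sub>R ((mat 1 - \<delta> *\<^sub>R H) *v y)
      - (\<delta> * sqrt (real n)) *\<^sub>R (G (ths + sqrt (real n) *\<^sub>R u) - G ths - H *v (sqrt (real n) *\<^sub>R u))"
proof -
  let ?\<sigma> = "sqrt (real n)"
  have "ths + ?\<sigma> *\<^sub>R u \<in> ball ths \<eta>" using h by (simp add: dist_norm)
  then have "sgd_drift M g \<delta> ths th0 n t y = real n *\<^sub>R (u - (\<delta> / ?\<sigma>) *\<^sub>R G (ths + ?\<sigma> *\<^sub>R u))"
    unfolding sgd_drift_def step by (simp add: integral_diff_scaleR_g)
  moreover have "real n * (\<delta> / ?\<sigma>) = \<delta> * ?\<sigma>" "\<delta> * ?\<sigma> * (?\<sigma> / kk) = \<delta> * (real n / kk)"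
    using n by (simp_all add: field_simps)
  ultimately show ?thesis
    by (simp add: u G_ths matrix_vector_mult_diff_rdistrib scaleR_matrix_vector_assoc
        matrix_vector_mult_scaleR algebra_simps)
qed

lemma sgd_diffusion_error_eq:
  assumes n: "0 < n" and h: "norm (sqrt (real n) *\<^sub>R u) < \<eta>"
    and step: "\<And>x. sgd_step g \<delta> ths th0 n (nat \<lfloor>real n * t\<rfloor>) y x - y =
      u - (\<delta> / sqrt (real n)) *\<^sub>R g x (ths + sqrt (real n) *\<^sub>R u)"
  defines "\<theta> \<equiv> ths + sqrt (real n) *\<^sub>R u"
  shows "sgd_diffusion M g \<delta> ths th0 n t y - \<delta>\<^sup>2 *\<^sub>R second_moment ths
    = real n *\<^sub>R outer u u - (\<delta> * sqrt (real n)) *\<^sub>R (outer u (G \<theta>) + outer (G \<theta>) u)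
      + \<delta>\<^sup>2 *\<^sub>R (second_moment \<theta> - second_moment ths)"
proof -
  let ?\<sigma> = "sqrt (real n)"
  have "\<theta> \<in> ball ths \<eta>" using h by (simp add: \<theta>_def dist_norm)
  then have "sgd_diffusion M g \<delta> ths th0 n t y = real n *\<^sub>R (outer u u
      - (\<delta> / ?\<sigma>) *\<^sub>R (outer u (G \<theta>) + outer (G \<theta>) u) + (\<delta> / ?\<sigma>)\<^sup>2 *\<^sub>R second_moment \<theta>)"
    unfolding sgd_diffusion_def step \<theta>_def by (simp add: integral_outer_diff_scaleR_g)
  moreover have "real n * (\<delta> / ?\<sigma>) = \<delta> * ?\<sigma>" "real n * (\<delta> / ?\<sigma>)\<^sup>2 = \<delta>\<^sup>2"
    using n by (simp_all add: field_simps power2_eq_square)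
  ultimately show ?thesis by (simp add: algebra_simps)
qed

lemma sgd_drift_error_le:
  fixes n :: nat
  assumes n: "4 \<le> real n * \<epsilon>" and \<epsilon>: "0 < \<epsilon>" "\<epsilon> \<le> t" and y: "norm y \<le> c"
    and small: "2 * c / \<epsilon> / sqrt (real n) < \<eta>" and \<rho>: "0 \<le> \<rho>"
    and remainder: "\<And>v. norm v \<le> 2 * c / \<epsilon> / sqrt (real n) \<Longrightarrow>
      norm (G (ths + v) - G ths - H *v v) \<le> \<rho> * norm v"
  shows "norm (sgd_drift M g \<delta> ths th0 n t y - (1 / t) *\<^sub>R ((mat 1 - \<delta> *\<^sub>R H) *v y))
    \<le> 4 / (\<epsilon>\<^sup>2 * real n) * (onorm ((*v) (mat 1 - \<delta> *\<^sub>R H)) * c) + \<bar>\<delta>\<bar> * \<rho> * (2 * c / \<epsilon>)"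
proof -
  define A where "A = mat 1 - \<delta> *\<^sub>R H"
  obtain kk u where n0: "0 < n" and u: "u = (1 / kk) *\<^sub>R y"
    and kk: "\<bar>real n / kk - 1 / t\<bar> \<le> 4 / (\<epsilon>\<^sup>2 * real n)"
    and h: "sqrt (real n) * norm (sqrt (real n) *\<^sub>R u) \<le> 2 * c / \<epsilon>"
      "norm (sqrt (real n) *\<^sub>R u) \<le> 2 * c / \<epsilon> / sqrt (real n)"
    and step: "\<And>x. sgd_step g \<delta> ths th0 n (nat \<lfloor>real n * t\<rfloor>) y x - y =
      u - (\<delta> / sqrt (real n)) *\<^sub>R g x (ths + sqrt (real n) *\<^sub>R u)"
    using sgd_step_rescaled[OF n \<epsilon> y] by metis
  let ?\<sigma> = "sqrt (real n)" and ?R = "G (ths + sqrt (real n) *\<^sub>R u) - G ths - H *v (sqrt (real n) *\<^sub>R u)"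
  have "norm (A *v y) \<le> onorm ((*v) A) * norm y"
    by (rule onorm[OF matrix_vector_mul_bounded_linear])
  also have "\<dots> \<le> onorm ((*v) A) * c"
    using y by (intro mult_left_mono onorm_pos_le matrix_vector_mul_bounded_linear)
  finally have "\<bar>real n / kk - 1 / t\<bar> * norm (A *v y) \<le> 4 / (\<epsilon>\<^sup>2 * real n) * (onorm ((*v) A) * c)"
    using kk by (intro mult_mono) auto
  then have first: "norm ((real n / kk - 1 / t) *\<^sub>R (A *v y)) \<le> 4 / (\<epsilon>\<^sup>2 * real n) * (onorm ((*v) A) * c)"
    by simp
  have "?\<sigma> * norm ?R \<le> ?\<sigma> * (\<rho> * norm (?\<sigma> *\<^sub>R u))"
    using remainder[OF h(2)] by (intro mult_left_mono) auto
  also have "\<dots> = \<rho> * (?\<sigma> * norm (?\<sigma> *\<^sub>R u))" by (simp only: mult_ac)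
  also have "\<dots> \<le> \<rho> * (2 * c / \<epsilon>)" using h(1) \<rho> by (rule mult_left_mono)
  finally have "\<bar>\<delta>\<bar> * (?\<sigma> * norm ?R) \<le> \<bar>\<delta>\<bar> * (\<rho> * (2 * c / \<epsilon>))" by (rule mult_left_mono) simp
  then have second: "norm ((\<delta> * ?\<sigma>) *\<^sub>R ?R) \<le> \<bar>\<delta>\<bar> * \<rho> * (2 * c / \<epsilon>)"
    by (simp add: abs_mult mult.assoc)
  have "sgd_drift M g \<delta> ths th0 n t y - (1 / t) *\<^sub>R (A *v y)
      = (real n / kk - 1 / t) *\<^sub>R (A *v y) - (\<delta> * ?\<sigma>) *\<^sub>R ?R"
    unfolding A_def using small h(2) by (intro sgd_drift_error_eq[OF n0 _ u step]) auto
  then have "norm (sgd_drift M g \<delta> ths th0 n t y - (1 / t) *\<^sub>R (A *v y))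
      \<le> norm ((real n / kk - 1 / t) *\<^sub>R (A *v y)) + norm ((\<delta> * ?\<sigma>) *\<^sub>R ?R)"
    by (simp only: norm_triangle_ineq4)
  then show ?thesis using first second unfolding A_def by linarith
qed

lemma sgd_drift_tendsto:
  assumes G': "(G has_derivative (\<lambda>v. H *v v)) (at ths)"
    and S: "S \<noteq> {}" "\<And>t y. (t, y) \<in> S \<Longrightarrow> \<epsilon> \<le> t \<and> norm y \<le> c" and \<epsilon>: "0 < \<epsilon>"
  shows "((\<lambda>n. SUP p\<in>S. ereal (norm (sgd_drift M g \<delta> ths th0 n (fst p) (snd p)
    - (1 / fst p) *\<^sub>R ((mat 1 - \<delta> *\<^sub>R H) *v snd p)))) \<longlongrightarrow> 0) sequentially"
proof (rule SUP_ereal_tendsto_0I[OF S(1) norm_ge_zero])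
  fix e :: real assume e: "0 < e"
  define Q where "Q = 2 * c / \<epsilon>"
  define K where "K = 4 / \<epsilon>\<^sup>2 * (onorm ((*v) (mat 1 - \<delta> *\<^sub>R H)) * c)"
  define \<rho> where "\<rho> = e / (2 * (\<bar>\<delta>\<bar> * Q + 1))"
  have "0 \<le> c" using S by (metis all_not_in_conv norm_ge_zero order_trans surj_pair)
  then have den: "0 < \<bar>\<delta>\<bar> * Q + 1" using \<epsilon> by (simp add: Q_def add_nonneg_pos)
  have \<rho>: "0 < \<rho>" "\<bar>\<delta>\<bar> * \<rho> * Q \<le> e / 2"
    using e den mult_right_mono[of "\<bar>\<delta>\<bar> * Q" "\<bar>\<delta>\<bar> * Q + 1" e] by (simp_all add: \<rho>_def field_simps)
  obtain d where d: "0 < d" "\<And>v. norm v < d \<Longrightarrow> norm (G (ths + v) - G ths - H *v v) \<le> \<rho> * norm v"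
    using G'[unfolded has_derivative_at_alt] \<rho>(1) by (metis add_diff_cancel_left')
  have "\<forall>\<^sub>F n in sequentially. 4 \<le> real n * \<epsilon>" using \<epsilon> by real_asymp
  moreover have "\<forall>\<^sub>F n in sequentially. Q / sqrt (real n) < min d \<eta>"
    using d eta_pos by (intro order_tendstoD(2)[of _ 0]) (real_asymp, simp)
  moreover have "\<forall>\<^sub>F n in sequentially. K / real n < e / 2"
    using e by (intro order_tendstoD(2)[of _ 0]) (real_asymp, simp)
  ultimately show "\<forall>\<^sub>F n in sequentially. \<forall>p\<in>S. norm (sgd_drift M g \<delta> ths th0 n (fst p) (snd p)
      - (1 / fst p) *\<^sub>R ((mat 1 - \<delta> *\<^sub>R H) *v snd p)) \<le> e"
  proof eventually_elim
    case (elim n)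
    show ?case
    proof
      fix p assume "p \<in> S"
      then obtain t y where p: "p = (t, y)" "\<epsilon> \<le> t" "norm y \<le> c" using S(2) by (cases p) blast
      have "norm (sgd_drift M g \<delta> ths th0 n t y - (1 / t) *\<^sub>R ((mat 1 - \<delta> *\<^sub>R H) *v y))
          \<le> K / real n + \<bar>\<delta>\<bar> * \<rho> * Q"
      proof (rule order_trans[OF sgd_drift_error_le[OF elim(1) \<epsilon> p(2,3), where \<rho>=\<rho>]])
        show "norm (G (ths + v) - G ths - H *v v) \<le> \<rho> * norm v"
          if "norm v \<le> 2 * c / \<epsilon> / sqrt (real n)" for v
          using that elim(2) by (intro d(2)) (simp add: Q_def)
      qed (use elim \<rho>(1) in \<open>auto simp: K_def Q_def\<close>)
      then show "norm (sgd_drift M g \<delta> ths th0 n (fst p) (snd p)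
          - (1 / fst p) *\<^sub>R ((mat 1 - \<delta> *\<^sub>R H) *v snd p)) \<le> e"
        using elim(3) \<rho>(2) unfolding p(1) fst_conv snd_conv by linarith
    qed
  qed
qed

lemma sgd_diffusion_error_le:
  fixes n :: nat
  assumes n: "4 \<le> real n * \<epsilon>" and \<epsilon>: "0 < \<epsilon>" "\<epsilon> \<le> t" and y: "norm y \<le> c"
    and small: "2 * c / \<epsilon> / sqrt (real n) < \<eta>"
    and moment: "\<And>\<theta>. norm (\<theta> - ths) \<le> 2 * c / \<epsilon> / sqrt (real n) \<Longrightarrow>
      norm (second_moment \<theta> - second_moment ths) \<le> \<rho>"
  shows "norm (sgd_diffusion M g \<delta> ths th0 n t y - \<delta>\<^sup>2 *\<^sub>R second_moment ths)
    \<le> (1 + 2 * \<bar>\<delta>\<bar> * L) * (2 * c / \<epsilon>)\<^sup>2 / real n + \<delta>\<^sup>2 * \<rho>"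
proof -
  define Q where "Q = 2 * c / \<epsilon>"
  obtain kk u where n0: "0 < n" and u: "real n * norm u \<le> Q" "norm u \<le> Q / real n"
    and h: "sqrt (real n) * norm (sqrt (real n) *\<^sub>R u) \<le> Q" "norm (sqrt (real n) *\<^sub>R u) \<le> Q / sqrt (real n)"
    and step: "\<And>x. sgd_step g \<delta> ths th0 n (nat \<lfloor>real n * t\<rfloor>) y x - y =
      u - (\<delta> / sqrt (real n)) *\<^sub>R g x (ths + sqrt (real n) *\<^sub>R u)"
    using sgd_step_rescaled[OF n \<epsilon> y] unfolding Q_def by metis
  let ?\<sigma> = "sqrt (real n)"
  define \<theta> where "\<theta> = ths + ?\<sigma> *\<^sub>R u"
  have Q: "0 \<le> Q" using u(1) by (metis mult_nonneg_nonneg norm_ge_zero of_nat_0_le_iff order_trans)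
  have "norm (real n *\<^sub>R outer u u) = (real n * norm u) * norm u" by (simp add: norm_outer)
  also have "\<dots> \<le> Q * (Q / real n)" using u Q by (intro mult_mono) auto
  finally have first: "norm (real n *\<^sub>R outer u u) \<le> Q\<^sup>2 / real n" by (simp add: power2_eq_square)
  have "norm (outer u (G \<theta>) + outer (G \<theta>) u) \<le> 2 * (norm u * (L * norm (?\<sigma> *\<^sub>R u)))"
    using norm_triangle_ineq[of "outer u (G \<theta>)" "outer (G \<theta>) u"] norm_G_le[of \<theta>]
      mult_left_mono[OF norm_G_le[of \<theta>], of "norm u"] by (simp add: norm_outer \<theta>_def mult.commute)
  then have "norm ((\<delta> * ?\<sigma>) *\<^sub>R (outer u (G \<theta>) + outer (G \<theta>) u))
      \<le> \<bar>\<delta>\<bar> * ?\<sigma> * (2 * (norm u * (L * norm (?\<sigma> *\<^sub>R u))))"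
    by (simp add: abs_mult mult_left_mono)
  also have "\<dots> = 2 * \<bar>\<delta>\<bar> * L * (?\<sigma> * norm (?\<sigma> *\<^sub>R u)) * norm u" by (simp only: mult_ac)
  also have "\<dots> \<le> 2 * \<bar>\<delta>\<bar> * L * Q * (Q / real n)"
    using h(1) u(2) Q L_pos by (intro mult_mono mult_left_mono) auto
  finally have second: "norm ((\<delta> * ?\<sigma>) *\<^sub>R (outer u (G \<theta>) + outer (G \<theta>) u)) \<le> 2 * \<bar>\<delta>\<bar> * L * Q\<^sup>2 / real n"
    by (simp add: power2_eq_square)
  have third: "norm (\<delta>\<^sup>2 *\<^sub>R (second_moment \<theta> - second_moment ths)) \<le> \<delta>\<^sup>2 * \<rho>"
    using moment[of \<theta>] h(2) unfolding \<theta>_def Q_def by (simp add: mult_left_mono)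
  have "sgd_diffusion M g \<delta> ths th0 n t y - \<delta>\<^sup>2 *\<^sub>R second_moment ths
      = real n *\<^sub>R outer u u - (\<delta> * ?\<sigma>) *\<^sub>R (outer u (G \<theta>) + outer (G \<theta>) u)
        + \<delta>\<^sup>2 *\<^sub>R (second_moment \<theta> - second_moment ths)"
    unfolding \<theta>_def using small h(2) Q_def by (intro sgd_diffusion_error_eq[OF n0 _ step]) auto
  moreover have "norm (a - b + c) \<le> norm a + norm b + norm c" for a b c :: "real^'d^'d"
    using norm_triangle_ineq[of "a - b" c] norm_triangle_ineq4[of a b] by linarith
  ultimately have "norm (sgd_diffusion M g \<delta> ths th0 n t y - \<delta>\<^sup>2 *\<^sub>R second_moment ths)
      \<le> Q\<^sup>2 / real n + 2 * \<bar>\<delta>\<bar> * L * Q\<^sup>2 / real n + \<delta>\<^sup>2 * \<rho>"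
    using first second third by (smt (verit))
  then show ?thesis unfolding Q_def[symmetric] by (simp add: add_divide_distrib distrib_right)
qed

lemma sgd_diffusion_tendsto:
  assumes cont: "AE x in M. isCont (g x) ths"
    and S: "S \<noteq> {}" "\<And>t y. (t, y) \<in> S \<Longrightarrow> \<epsilon> \<le> t \<and> norm y \<le> c" and \<epsilon>: "0 < \<epsilon>"
  shows "((\<lambda>n. SUP p\<in>S. ereal (norm (sgd_diffusion M g \<delta> ths th0 n (fst p) (snd p)
    - \<delta>\<^sup>2 *\<^sub>R second_moment ths))) \<longlongrightarrow> 0) sequentially"
proof (rule SUP_ereal_tendsto_0I[OF S(1) norm_ge_zero])
  fix e :: real assume e: "0 < e"
  define Q where "Q = 2 * c / \<epsilon>"
  define \<rho> where "\<rho> = e / (2 * (\<delta>\<^sup>2 + 1))"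
  have \<rho>: "0 < \<rho>" "\<delta>\<^sup>2 * \<rho> \<le> e / 2"
    using e mult_right_mono[of "\<delta>\<^sup>2" "\<delta>\<^sup>2 + 1" e] by (simp_all add: \<rho>_def field_simps add_pos_nonneg)
  obtain d where d: "0 < d" "\<And>\<theta>. dist \<theta> ths < d \<Longrightarrow> dist (second_moment \<theta>) (second_moment ths) < \<rho>"
    using isCont_second_moment[OF cont, unfolded continuous_at_eps_delta] \<rho>(1) by blast
  have "\<forall>\<^sub>F n in sequentially. 4 \<le> real n * \<epsilon>" using \<epsilon> by real_asymp
  moreover have "\<forall>\<^sub>F n in sequentially. Q / sqrt (real n) < min d \<eta>"
    using d eta_pos by (intro order_tendstoD(2)[of _ 0]) (real_asymp, simp)
  moreover have "\<forall>\<^sub>F n in sequentially. (1 + 2 * \<bar>\<delta>\<bar> * L) * Q\<^sup>2 / real n < e / 2"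
    using e by (intro order_tendstoD(2)[of _ 0]) (real_asymp, simp)
  ultimately show "\<forall>\<^sub>F n in sequentially. \<forall>p\<in>S. norm (sgd_diffusion M g \<delta> ths th0 n (fst p) (snd p)
      - \<delta>\<^sup>2 *\<^sub>R second_moment ths) \<le> e"
  proof eventually_elim
    case (elim n)
    show ?case
    proof
      fix p assume "p \<in> S"
      then obtain t y where p: "p = (t, y)" "\<epsilon> \<le> t" "norm y \<le> c" using S(2) by (cases p) blast
      have "norm (sgd_diffusion M g \<delta> ths th0 n t y - \<delta>\<^sup>2 *\<^sub>R second_moment ths)
          \<le> (1 + 2 * \<bar>\<delta>\<bar> * L) * Q\<^sup>2 / real n + \<delta>\<^sup>2 * \<rho>"
        using elim d(2) unfolding Q_def
        by (intro sgd_diffusion_error_le[OF elim(1) \<epsilon> p(2,3)]) (auto simp: dist_norm less_imp_le)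
      then show "norm (sgd_diffusion M g \<delta> ths th0 n (fst p) (snd p)
          - \<delta>\<^sup>2 *\<^sub>R second_moment ths) \<le> e"
        using elim(3) \<rho>(2) unfolding p(1) fst_conv snd_conv by linarith
    qed
  qed
qed

end

locale sgd_convex = sgd_noise M g G ths L \<eta> s
  for M :: "'e measure" and g :: "'e \<Rightarrow> real^'d \<Rightarrow> real^'d" and G ths L \<eta> s +
  fixes \<phi> :: "'e \<Rightarrow> real^'d \<Rightarrow> real" and \<Phi> :: "real^'d \<Rightarrow> real"
  assumes phi_integrable: "\<And>\<theta>. integrable M (\<lambda>x. \<phi> x \<theta>)"
    and phi_convex: "\<And>x. x \<in> space M \<Longrightarrow> convex_on UNIV (\<phi> x)"
    and g_subgradient: "AE x in M. \<forall>\<theta> \<theta>'. \<phi> x \<theta> + g x \<theta> \<bullet> (\<theta>' - \<theta>) \<le> \<phi> x \<theta>'"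
    and Phi_eq: "\<Phi> = (\<lambda>\<theta>. \<integral>x. \<phi> x \<theta> \<partial>M)"
begin

lemma Phi_subgradient:
  assumes "\<theta> \<in> ball ths \<eta>"
  shows "\<Phi> \<theta> + G \<theta> \<bullet> (\<theta>' - \<theta>) \<le> \<Phi> \<theta>'"
proof -
  have "G \<theta> \<bullet> (\<theta>' - \<theta>) = (\<integral>x. g x \<theta> \<bullet> (\<theta>' - \<theta>) \<partial>M)"
    unfolding G_eq using integrable_g[OF assms] by simp
  also have "\<dots> \<le> (\<integral>x. \<phi> x \<theta>' - \<phi> x \<theta> \<partial>M)"
  proof (rule integral_mono_AE)
    show "integrable M (\<lambda>x. g x \<theta> \<bullet> (\<theta>' - \<theta>))"
      using integrable_g[OF assms] by (rule integrable_inner_left)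
    show "integrable M (\<lambda>x. \<phi> x \<theta>' - \<phi> x \<theta>)" using phi_integrable by simp
    show "AE x in M. g x \<theta> \<bullet> (\<theta>' - \<theta>) \<le> \<phi> x \<theta>' - \<phi> x \<theta>"
      using g_subgradient by eventually_elim (metis add.commute le_diff_eq)
  qed
  also have "\<dots> = \<Phi> \<theta>' - \<Phi> \<theta>" unfolding Phi_eq using phi_integrable by simp
  finally show ?thesis by simp
qed

lemma G_has_derivative:
  assumes "C2_near_with_hessian \<Phi> ths H"
  shows "(G has_derivative (\<lambda>v. H *v v)) (at ths)"
proof -
  from assms obtain U grad Hess where U: "open U" "ths \<in> U"
    and grad: "\<forall>\<theta>\<in>U. (\<Phi> has_derivative (\<lambda>v. grad \<theta> \<bullet> v)) (at \<theta>)"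
    and Hess: "\<forall>\<theta>\<in>U. (grad has_derivative (\<lambda>v. Hess \<theta> *v v)) (at \<theta>)" "Hess ths = H"
    unfolding C2_near_with_hessian_def by blast
  have grad_eq: "grad \<theta> = G \<theta>" if \<theta>: "\<theta> \<in> U \<inter> ball ths \<eta>" for \<theta>
  proof (rule subgradient_eq_derivative)
    show "(\<Phi> has_derivative (\<lambda>v. grad \<theta> \<bullet> v)) (at \<theta>)" using grad \<theta> by blast
    show "\<Phi> \<theta> + G \<theta> \<bullet> (\<theta>' - \<theta>) \<le> \<Phi> \<theta>'" for \<theta>' using Phi_subgradient \<theta> by blast
  qed
  have "(grad has_derivative (\<lambda>v. H *v v)) (at ths)" using Hess U(2) by metis
  then show ?thesis
  proof (rule has_derivative_transform_within_open)
    show "open (U \<inter> ball ths \<eta>)" "ths \<in> U \<inter> ball ths \<eta>" using U eta_pos by auto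
  qed (rule grad_eq)
qed

lemma Phi_increment_le:
  assumes "\<theta> \<in> ball ths \<eta>"
  shows "\<Phi> \<theta> - \<Phi> ths \<le> L * (norm (\<theta> - ths))\<^sup>2"
proof -
  have "\<Phi> \<theta> - \<Phi> ths \<le> G \<theta> \<bullet> (\<theta> - ths)"
    using Phi_subgradient[OF assms, of ths] inner_minus_right[of "G \<theta>" "\<theta> - ths"] by simp
  also have "\<dots> \<le> norm (G \<theta>) * norm (\<theta> - ths)" by (rule norm_cauchy_schwarz)
  also have "\<dots> \<le> L * norm (\<theta> - ths) * norm (\<theta> - ths)"
    using norm_G_le[of \<theta>] by (intro mult_right_mono) auto
  finally show ?thesis by (simp add: power2_eq_square mult.assoc)
qed

lemma AE_directional_quotient_le:
  assumes w: "norm w = 1"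
  shows "AE x in M. \<forall>e>0. \<exists>t>0. (\<phi> x (ths + t *\<^sub>R w) - \<phi> x ths) / t \<le> g x ths \<bullet> w + e"
proof -
  define t where "t j = \<eta> / real (j + 2)" for j :: nat
  have t: "0 < t j" "ths + t j *\<^sub>R w \<in> ball ths \<eta>" for j
    using eta_pos w by (auto simp: t_def dist_norm field_simps intro: add_pos_nonneg)
  have ths: "ths \<in> ball ths \<eta>" using eta_pos by simp
  define C where "C j x = (\<phi> x (ths + t j *\<^sub>R w) - \<phi> x ths) / t j - g x ths \<bullet> w" for j x
  have C_int: "integrable M (C j)" for j
    unfolding C_def using phi_integrable integrable_g[OF ths]
    by (intro Bochner_Integration.integrable_diff Bochner_Integration.integrable_divide integrable_inner_left)
  have C_nonneg: "AE x in M. \<forall>j. 0 \<le> C j x"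
    using g_subgradient
  proof eventually_elim
    case (elim x)
    have "t j * (g x ths \<bullet> w) \<le> \<phi> x (ths + t j *\<^sub>R w) - \<phi> x ths" for j
      using elim[rule_format, of ths "ths + t j *\<^sub>R w"] by simp
    then show ?case using t(1) by (simp add: C_def field_simps)
  qed
  have C_integral: "(\<integral>x. C j x \<partial>M) = (\<Phi> (ths + t j *\<^sub>R w) - \<Phi> ths) / t j" for j
    unfolding C_def Phi_eq using phi_integrable integrable_g[OF ths] G_ths by (simp add: G_eq)
  have "(\<lambda>j. \<integral>x. C j x \<partial>M) \<longlonglongrightarrow> 0"
  proof (rule tendsto_sandwich[of "\<lambda>_. 0" _ _ "\<lambda>j. L * t j"])
    have "0 \<le> (\<integral>x. C j x \<partial>M)" for j
    proof (rule integral_nonneg_AE)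
      show "AE x in M. 0 \<le> C j x" using C_nonneg by eventually_elim simp
    qed
    then show "\<forall>\<^sub>F j in sequentially. 0 \<le> (\<integral>x. C j x \<partial>M)" by simp
    show "\<forall>\<^sub>F j in sequentially. (\<integral>x. C j x \<partial>M) \<le> L * t j"
      using Phi_increment_le[OF t(2)] t(1) w
      by (intro always_eventually allI) (simp add: C_integral divide_le_eq power2_eq_square mult.assoc)
    show "(\<lambda>j. L * t j) \<longlonglongrightarrow> 0" unfolding t_def by real_asymp
  qed simp
  with C_int C_nonneg have "AE x in M. \<forall>e>0. \<exists>j. C j x < e"
    by (rule AE_ex_less_of_integral_tendsto_0)
  then show ?thesis
  proof eventually_elim
    case (elim x)
    show ?case
    proof (intro allI impI)
      fix e :: real assume "0 < e"
      with elim obtain j where "C j x < e" by blast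
      then show "\<exists>t>0. (\<phi> x (ths + t *\<^sub>R w) - \<phi> x ths) / t \<le> g x ths \<bullet> w + e"
        using t(1)[of j] unfolding C_def by (intro exI[of _ "t j"]) auto
    qed
  qed
qed

lemma AE_isCont_g: "AE x in M. isCont (g x) ths"
proof -
  have "AE x in M. \<forall>i\<in>UNIV. \<forall>w\<in>{axis i 1, - axis i 1}.
      \<forall>e>0. \<exists>t>0. (\<phi> x (ths + t *\<^sub>R w) - \<phi> x ths) / t \<le> g x ths \<bullet> w + e"
    by (intro AE_finite_allI AE_directional_quotient_le) auto
  then show ?thesis
    using g_subgradient AE_space
  proof eventually_elim
    case (elim x)
    show ?case
    proof (rule isCont_subgradient[OF phi_convex[OF elim(3)]])
      show "\<phi> x \<theta> + g x \<theta> \<bullet> (\<theta>' - \<theta>) \<le> \<phi> x \<theta>'" for \<theta> \<theta>'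
        using elim(2) by blast
      show "\<exists>t>0. (\<phi> x (ths + t *\<^sub>R w) - \<phi> x ths) / t \<le> g x ths \<bullet> w + e"
        if "w \<in> {axis i 1, - axis i 1}" "0 < e" for i w e
        using elim(1) that by blast
    qed
  qed
qed

end

theorem proposition2:
  fixes M :: "'e measure"
    and \<phi> :: "'e \<Rightarrow> real^'d \<Rightarrow> real"
    and g :: "'e \<Rightarrow> real^'d \<Rightarrow> real^'d"
    and \<Phi> :: "real^'d \<Rightarrow> real"
    and G :: "real^'d \<Rightarrow> real^'d"
    and ths th0 :: "real^'d"
    and H \<Gamma> :: "real^'d^'d"
    and L \<eta> \<delta> R r \<epsilon> T :: real
  assumes M: "prob_space M"
    and phi_meas: "\<And>\<theta>. (\<lambda>x. \<phi> x \<theta>) \<in> borel_measurable M"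
    and phi_convex: "\<And>x. x \<in> space M \<Longrightarrow> convex_on UNIV (\<phi> x)"
    and phi_int: "\<And>\<theta>. integrable M (\<lambda>x. \<phi> x \<theta>)"
    and g_meas: "\<And>\<theta>. (\<lambda>x. g x \<theta>) \<in> borel_measurable M"
    and g_subgrad: "AE x in M. \<forall>\<theta> \<theta>'. \<phi> x \<theta>' \<ge> \<phi> x \<theta> + g x \<theta> \<bullet> (\<theta>' - \<theta>)"
    and Phi_def: "\<Phi> = (\<lambda>\<theta>. \<integral>x. \<phi> x \<theta> \<partial>M)"
    and G_def: "G = (\<lambda>\<theta>. \<integral>x. g x \<theta> \<partial>M)"
    and min: "\<forall>\<theta>. \<Phi> ths \<le> \<Phi> \<theta>"
    and min_unique: "\<forall>\<theta>. (\<forall>\<theta>'. \<Phi> \<theta> \<le> \<Phi> \<theta>') \<longrightarrow> \<theta> = ths"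
    and C2: "C2_near_with_hessian \<Phi> ths H"
    and posdef: "pos_def_matrix H"
    and L: "L > 0" "\<forall>\<theta>. norm (G \<theta>) \<le> L * norm (\<theta> - ths)"
    and eta: "\<eta> > 0"
    and sup_meas: "(\<lambda>x. SUP \<theta>\<in>ball ths \<eta>. ennreal ((norm (g x \<theta> - G \<theta>))\<^sup>2)) \<in> borel_measurable M"
    and sup_fin: "(\<integral>\<^sup>+x. (SUP \<theta>\<in>ball ths \<eta>. ennreal ((norm (g x \<theta> - G \<theta>))\<^sup>2)) \<partial>M) < \<infinity>"
    and Gamma_fin: "integrable M (\<lambda>x. outer (g x ths) (g x ths))"
    and Gamma_def: "\<Gamma> = (\<integral>x. outer (g x ths) (g x ths) \<partial>M)"
    and delta: "\<delta> > 1 / min_eigenvalue H"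
    and Rr: "R > 0" "r > 0"
    and epsT: "0 < \<epsilon>" "\<epsilon> < T"
  shows
    "((\<lambda>n::nat. SUP p\<in>{\<epsilon>..T} \<times> ball ths R.
        ereal (real n * sgd_kernel M g \<delta> ths th0 n (nat \<lfloor>real n * fst p\<rfloor>) (snd p)
                         (- ball (snd p) r))) \<longlongrightarrow> 0) sequentially
   \<and> ((\<lambda>n::nat. SUP p\<in>{\<epsilon>..T} \<times> ball ths R.
        ereal (norm (sgd_drift M g \<delta> ths th0 n (fst p) (snd p)
                     - (1 / fst p) *\<^sub>R ((mat 1 - \<delta> *\<^sub>R H) *v snd p)))) \<longlongrightarrow> 0) sequentially
   \<and> ((\<lambda>n::nat. SUP p\<in>{\<epsilon>..T} \<times> ball ths R.
        ereal (norm (sgd_diffusion M g \<delta> ths th0 n (fst p) (snd p) - \<delta>\<^sup>2 *\<^sub>R \<Gamma>))) \<longlongrightarrow> 0) sequentially"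
proof -
  interpret prob_space M by (rule M)
  define S where "S x = (SUP \<theta>\<in>ball ths \<eta>. ennreal ((norm (g x \<theta> - G \<theta>))\<^sup>2))" for x
  interpret sgd_convex M g G ths L \<eta> "\<lambda>x. enn2real (S x)" \<phi> \<Phi>
  proof unfold_locales
    show "integrable M (\<lambda>x. enn2real (S x))"
      and "AE x in M. \<forall>\<theta>\<in>ball ths \<eta>. (norm (g x \<theta> - G \<theta>))\<^sup>2 \<le> enn2real (S x)"
      using integrable_envelope_enn2real_SUP[OF sup_meas sup_fin] unfolding S_def by auto
    show "0 \<le> enn2real (S x)" for x by simp
  qed (fact g_meas G_def L(1) eta phi_int phi_convex g_subgrad Phi_def | use L(2) in blast)+
  define Y where "Y = {\<epsilon>..T} \<times> ball ths R"
  have Y_ne: "Y \<noteq> {}" using epsT Rr by (auto simp: Y_def)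
  have Y_bound: "\<epsilon> \<le> t \<and> norm y \<le> norm ths + R" if "(t, y) \<in> Y" for t y
  proof -
    have "norm y \<le> norm ths + norm (y - ths)" using norm_triangle_ineq[of ths "y - ths"] by simp
    with that show ?thesis by (simp add: Y_def dist_norm norm_minus_commute)
  qed
  note Y = Y_ne Y_bound
  have \<Gamma>: "\<Gamma> = second_moment ths" unfolding Gamma_def second_moment_def ..
  note kernel = sgd_kernel_escape_tendsto_0[OF Y epsT(1) Rr(2), unfolded Y_def]
    and drift = sgd_drift_tendsto[OF G_has_derivative[OF C2] Y epsT(1), unfolded Y_def]
    and diffusion = sgd_diffusion_tendsto[OF AE_isCont_g Y epsT(1), unfolded Y_def]
  show ?thesis unfolding \<Gamma> by (intro conjI kernel drift diffusion)
qed

end
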